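(* Let $\alpha>0$ be an integer, let $p\ge 3$ be a prime, and let $r\ge 0$ be an integer that is a quadratic nonresidue modulo $p$. Then for every integer $n\ge 0$, $$v_0(2^{2\alpha+2}(pn+r))\equiv 0 \pmod{2^{3\alpha+2}}.$$
   Context: The integer sequence $v_0(n)$, $n\ge 0$, is defined by the generating function (formal power series in $q$) $$\sum_{n=0}^\infty v_0(n)q^n=\sum_{n=0}^\infty \frac{q^{n^2}(-q;q^2)_n}{(q;q^2)_n},$$ where $(a;q)_0=1$ and $(a;q)_n=\prod_{i=1}^n(1-aq^{i-1})$ for $n\ge1$, so that $(-q;q^2)_n=\prod_{i=1}^n(1+q^{2i-1})$ and $(q;q^2)_n=\prod_{i=1}^n(1-q^{2i-1})$. *)

theory Defs
  imports
    "HOL-Computational_Algebra.Computational_Algebra"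
    "HOL-Number_Theory.Number_Theory"
begin

definition qpochhammer :: "'a::comm_ring_1 \<Rightarrow> 'a \<Rightarrow> nat \<Rightarrow> 'a" where
  "qpochhammer a q n = (\<Prod>i = 1..n. 1 - a * q ^ (i - 1))"

text \<open>
  Since \<open>int\<close> is not a field, \<open>inverse\<close> and \<open>/\<close> are not available on integer power series.
  The denominator \<open>(q; q\<^sup>2)\<^sub>n\<close> has constant term 1, so it is inverted in the ring of
  integer power series by \<^term>\<open>fps_right_inverse\<close>, whose second argument is the inverse of
  the constant term; see \<open>qpochhammer_mult_inverse\<close> below.
\<close>

definition v0_term :: "nat \<Rightarrow> int fps" where
  "v0_term n = fps_X ^ (n\<^sup>2) * qpochhammer (- fps_X) (fps_X\<^sup>2) n
                 * fps_right_inverse (qpochhammer fps_X (fps_X\<^sup>2) n) 1"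

text \<open>The infinite sum is taken in the \<open>X\<close>-adic topology; it converges by \<open>v0_term_sums\<close> below.\<close>

definition v0_gf :: "int fps" where
  "v0_gf = (\<Sum>n. v0_term n)"

definition v0 :: "nat \<Rightarrow> int" where
  "v0 n = fps_nth v0_gf n"

lemma qpochhammer_fps_X_nth_0:
  "fps_nth (qpochhammer (fps_X :: int fps) (fps_X\<^sup>2) n) 0 = 1"
  by (induction n) (simp_all add: qpochhammer_def)

lemma qpochhammer_mult_inverse:
  "qpochhammer (fps_X :: int fps) (fps_X\<^sup>2) n
     * fps_right_inverse (qpochhammer fps_X (fps_X\<^sup>2) n) 1 = 1"
  by (rule fps_right_inverse) (simp add: qpochhammer_fps_X_nth_0)

lemma v0_term_nth_eq_0:
  assumes "m < n"
  shows "fps_nth (v0_term n) m = 0"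
proof -
  have "m < n\<^sup>2"
    using assms power2_nat_le_imp_le[of n "n\<^sup>2"] self_le_power[of n 2] by (cases n) auto
  then show ?thesis
    by (simp add: v0_term_def mult.assoc fps_X_power_mult_nth)
qed

lemma v0_term_sums: "v0_term sums v0_gf"
proof -
  define g where "g = Abs_fps (\<lambda>m. \<Sum>n\<le>m. fps_nth (v0_term n) m)"
  have "(\<lambda>N. \<Sum>n<N. v0_term n) \<longlonglongrightarrow> g"
  proof (rule tendsto_fpsI)
    fix m
    have "fps_nth (\<Sum>n<N. v0_term n) m = fps_nth g m" if "N > m" for N
    proof -
      have "(\<Sum>n<N. fps_nth (v0_term n) m) = (\<Sum>n\<le>m. fps_nth (v0_term n) m)"
        by (rule sum.mono_neutral_right) (use that v0_term_nth_eq_0 in auto)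
      then show ?thesis
        by (simp add: g_def fps_sum_nth)
    qed
    then show "\<forall>\<^sub>F N in sequentially. fps_nth (\<Sum>n<N. v0_term n) m = fps_nth g m"
      by (rule eventually_mono[OF eventually_gt_at_top[of m]])
  qed
  then have "v0_term sums g"
    by (simp add: sums_def)
  then show ?thesis
    by (simp add: v0_gf_def sums_iff)
qed

end

theory Submission
  imports Defs
begin

text \<open>
  Write \<open>P = \<phi>(q)\<close> and \<open>M = \<phi>(-q)\<close> for the theta series \<open>\<Sum>q\<^bsup>n\<^sup>2\<^esup>\<close> over all integers \<open>n\<close>.
  The series \<open>F(q) + F(-q) - 1\<close>, with \<open>F\<close> the generating function of \<open>v\<^sub>0\<close>, is a bilateral sum.
  A telescoping shift of its parameters evaluates it as a product times a theta series, and together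
  with Gauss' product for \<open>M\<close> this gives \<open>P(q\<^sup>2)\<^sup>2 / M(q\<^sup>4)\<close>. Hence \<open>2 \<Sum>v\<^sub>0(4n)q\<^sup>n - 1 = P\<^sup>2 / M\<close>.

  Let \<open>U\<close> extract every fourth coefficient and put \<open>u = (P/M)\<^sup>4 - 1\<close>, which is divisible by 16.
  In terms of the ratio \<open>b\<close> of the odd part of \<open>P\<close> to its even part, \<open>P\<^sup>2/M\<close> and all \<open>P u\<^sup>k\<close> become
  explicit polynomials in \<open>b\<close> and in series in \<open>q\<^sup>4\<close>, and \<open>U\<close> keeps the powers of \<open>b\<^sup>4\<close>.
  This yields \<open>U P = P\<close>, \<open>U(P\<^sup>2/M) = P + 4 P u\<close>, and \<open>U(P u\<^sup>k) \<in> 8 P u \<int>[u]\<close> for \<open>k \<ge> 1\<close>.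
  Iterating \<open>\<alpha>\<close> times, \<open>2 v\<^sub>0(4\<^bsup>\<alpha>+1\<^esup>m)\<close> agrees modulo \<open>2\<^bsup>3\<alpha>+3\<^esup>\<close> with the coefficient of \<open>q\<^sup>m\<close> in \<open>P\<close>,
  which vanishes unless \<open>m\<close> is a square.
\<close>

section \<open>Congruence of power series up to a given order\<close>

text \<open>Equality modulo \<open>fps_X ^ N\<close>. It lets finite products stand in for the
  classical infinite ones: an equation of series follows once it holds to every order
  \<open>N\<close>.\<close>

definition fps_eq_upto :: "nat \<Rightarrow> int fps \<Rightarrow> int fps \<Rightarrow> bool" where
  "fps_eq_upto N f g \<longleftrightarrow> (\<forall>i<N. fps_nth f i = fps_nth g i)"

lemma fps_eq_upto_refl [simp]: "fps_eq_upto N f f"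
  by (simp add: fps_eq_upto_def)

lemma fps_eq_upto_sym: "fps_eq_upto N f g \<Longrightarrow> fps_eq_upto N g f"
  by (simp add: fps_eq_upto_def)

lemma fps_eq_upto_trans [trans]:
  "fps_eq_upto N f g \<Longrightarrow> fps_eq_upto N g h \<Longrightarrow> fps_eq_upto N f h"
  by (simp add: fps_eq_upto_def)

lemma fps_eq_upto_mono: "fps_eq_upto N f g \<Longrightarrow> N' \<le> N \<Longrightarrow> fps_eq_upto N' f g"
  by (simp add: fps_eq_upto_def)

lemma fps_eq_upto_add:
  "fps_eq_upto N f g \<Longrightarrow> fps_eq_upto N f' g' \<Longrightarrow> fps_eq_upto N (f + f') (g + g')"
  by (simp add: fps_eq_upto_def)

lemma fps_eq_upto_diff:
  "fps_eq_upto N f g \<Longrightarrow> fps_eq_upto N f' g' \<Longrightarrow> fps_eq_upto N (f - f') (g - g')"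
  by (simp add: fps_eq_upto_def)

lemma fps_eq_upto_mult:
  "fps_eq_upto N f g \<Longrightarrow> fps_eq_upto N f' g' \<Longrightarrow> fps_eq_upto N (f * f') (g * g')"
  unfolding fps_eq_upto_def by (auto simp: fps_mult_nth intro!: sum.cong)

lemma fps_eq_upto_sum:
  "(\<And>x. x \<in> S \<Longrightarrow> fps_eq_upto N (f x) (g x)) \<Longrightarrow> fps_eq_upto N (sum f S) (sum g S)"
  unfolding fps_eq_upto_def by (auto simp: fps_sum_nth intro!: sum.cong)

lemma fps_eq_upto_iff_dvd: "fps_eq_upto N f g \<longleftrightarrow> fps_X ^ N dvd f - g"
proof
  assume "fps_X ^ N dvd f - g"
  then obtain h where "f - g = fps_X ^ N * h" ..
  then have "fps_nth (f - g) i = 0" if "i < N" for i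
    using that by (simp only: fps_X_power_mult_nth if_True)
  then show "fps_eq_upto N f g"
    by (simp add: fps_eq_upto_def)
next
  assume *: "fps_eq_upto N f g"
  have "f - g = fps_X ^ N * Abs_fps (\<lambda>n. fps_nth (f - g) (n + N))"
    by (rule fps_ext) (use * in \<open>auto simp: fps_X_power_mult_nth fps_eq_upto_def\<close>)
  then show "fps_X ^ N dvd f - g" ..
qed

text \<open>A factor with constant term 1 is a unit among integer power series, so it cancels modulo
  \<open>fps_X ^ N\<close>.\<close>

lemma fps_eq_upto_cong_mult_right:
  assumes "fps_eq_upto N (f * h) (g * h)" "fps_nth h 0 = 1"
  shows "fps_eq_upto N f g"
proof -
  have h: "h * fps_right_inverse h 1 = 1"
    using assms(2) by (intro fps_right_inverse) simp
  have "fps_eq_upto N (f * h * fps_right_inverse h 1) (g * h * fps_right_inverse h 1)"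
    using assms(1) by (rule fps_eq_upto_mult) simp
  then show ?thesis
    by (simp only: mult.assoc h mult_1_right)
qed

lemma fps_eqI_upto: "(\<And>N. fps_eq_upto N f g) \<Longrightarrow> f = g"
  by (rule fps_ext) (auto simp: fps_eq_upto_def)

section \<open>Substituting \<open>- fps_X\<close> and powers of \<open>fps_X\<close>;
  inverses\<close>

lemma fps_compose_uminus_X_nth [simp]:
  fixes f :: "int fps"
  shows "fps_nth (f oo - fps_X) n = (- 1) ^ n * fps_nth f n"
proof -
  have "fps_const (- 1) * fps_X = (- fps_X :: int fps)"
    by (simp flip: fps_const_neg)
  then show ?thesis
    by (metis fps_nth_compose_linear)
qed

lemma fps_eq_upto_compose_uminus_X:
  "fps_eq_upto N f g \<Longrightarrow> fps_eq_upto N (f oo - fps_X) (g oo - fps_X)"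
  by (simp add: fps_eq_upto_def)

lemma fps_compose_X_power_nth:
  fixes f :: "int fps"
  assumes "k > 0"
  shows "fps_nth (f oo fps_X ^ k) n = (if k dvd n then fps_nth f (n div k) else 0)"
proof -
  have "fps_nth (f oo fps_X ^ k) n = (\<Sum>i=0..n. if k * i = n then fps_nth f i else 0)"
    unfolding fps_compose_nth power_mult[symmetric] by (intro sum.cong) auto
  also have "\<dots> = (\<Sum>i\<in>{i. k * i = n}. fps_nth f i)"
    by (intro sum.mono_neutral_cong_right finite_subset[of "{i. k * i = n}" "{0..n}"])
       (use assms in auto)
  also have "\<dots> = (if k dvd n then fps_nth f (n div k) else 0)"
  proof (cases "k dvd n")
    case True
    then have "{i. k * i = n} = {n div k}"
      using assms by auto
    then show ?thesis using True by simp
  next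
    case False
    then have "{i. k * i = n} = {}"
      by auto
    then show ?thesis using False by simp
  qed
  finally show ?thesis .
qed

lemma fps_eq_upto_compose_X_power:
  assumes "fps_eq_upto N f g" "k > 0"
  shows "fps_eq_upto (k * N) (f oo fps_X ^ k) (g oo fps_X ^ k)"
  using assms by (auto simp: fps_eq_upto_def fps_compose_X_power_nth elim!: dvdE)

abbreviation rinv :: "int fps \<Rightarrow> int fps" where
  "rinv f \<equiv> fps_right_inverse f 1"

lemma rinv: "fps_nth f 0 = 1 \<Longrightarrow> f * rinv f = 1"
  by (rule fps_right_inverse) simp

lemma rinv_unique:
  assumes "f * g = 1" "fps_nth f 0 = 1"
  shows "g = rinv f"
proof -
  have "g = g * (f * rinv f)"
    by (simp add: rinv[OF assms(2)])
  also have "\<dots> = f * g * rinv f"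
    by (simp only: mult_ac)
  finally show ?thesis
    by (simp add: assms(1))
qed

section \<open>A two-sided basic hypergeometric sum\<close>

text \<open>
  With \<open>t = a s\<close> and \<open>a\<^sup>2 = 1\<close>, the terms with negative index of the bilateral sum are those
  with \<open>s\<close> and \<open>t\<close> exchanged; this is the second half of \<open>bilat_sum\<close> below.
\<close>

primrec bilat :: "int fps \<Rightarrow> int fps \<Rightarrow> int fps \<Rightarrow> int fps \<Rightarrow> nat \<Rightarrow> int fps" where
  "bilat l a s t 0 = 1"
| "bilat l a s t (Suc n) = bilat l a s t n * a * (l * fps_X) ^ n * fps_X
     * (s - l * (l * fps_X) ^ n) * rinv (1 - t * fps_X * (l * fps_X) ^ n)"

lemma X_power_dvd_bilat: "fps_X ^ n dvd bilat l a s t n"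
proof (induction n)
  case (Suc n)
  then show ?case
    by (auto simp: elim!: dvdE)
qed auto

lemma rinv_one_minus_X:
  "(1 - t * fps_X * f) * rinv (1 - t * fps_X * f) = 1"
  by (intro rinv) simp

text \<open>Put \<open>S = s * fps_X\<close> and \<open>T = t * fps_X\<close>. Then
  \<open>bilat l a s t n\<close> is the product over \<open>j < n\<close> of
  \<open>a * Q^j * (S - Q^(j+1)) / (1 - T * Q^j)\<close>. Replacing \<open>S\<close>,
  \<open>T\<close> by \<open>Q * S\<close>, \<open>Q * T\<close> moves numerators and denominators
  by one place, so only boundary factors and a power of \<open>Q\<close> differ.\<close>

lemma bilat_shift_Suc:
  fixes l a s t :: "int fps"
  defines "Q \<equiv> l * fps_X"
  defines "r \<equiv> (\<lambda>n. rinv (1 - t * fps_X * Q ^ n))"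
  shows "bilat l a (Q * s) (Q * t) (Suc n) =
           - (1 - s * fps_X) * (1 - t * fps_X) * a * Q ^ (2 * n + 1) * r (Suc n) * r n * bilat l a s t n"
proof (induction n)
  case 0
  have *: "(1 - t * fps_X) * r 0 = 1"
    using rinv_one_minus_X[of t 1] by (simp add: r_def)
  have "bilat l a (Q * s) (Q * t) (Suc 0) = a * fps_X * (Q * s - l) * r 1"
    by (simp add: Q_def r_def mult_ac)
  also have "\<dots> = - (1 - s * fps_X) * ((1 - t * fps_X) * r 0) * a * Q * r 1"
    unfolding * by (simp add: Q_def algebra_simps)
  finally show ?case
    by (simp add: algebra_simps)
next
  case (Suc n)
  have 1: "bilat l a (Q * s) (Q * t) (Suc (Suc n)) = bilat l a (Q * s) (Q * t) (Suc n) * a * Q ^ Suc n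
     * fps_X * (Q * s - l * Q ^ Suc n) * r (Suc (Suc n))"
    unfolding bilat.simps(2)[of _ _ _ _ "Suc n"] by (simp add: Q_def r_def mult_ac)
  have 2: "bilat l a s t (Suc n) = bilat l a s t n * a * Q ^ n * fps_X * (s - l * Q ^ n) * r n"
    by (simp add: Q_def r_def)
  show ?case
    unfolding 1 2 Suc.IH by (simp add: algebra_simps)
qed

text \<open>\<open>K\<close> is a telescoping certificate: every term is a multiple of
  \<open>y\<close> below, and what remains is a rational identity in
  \<open>x = Q ^ Suc n\<close>.\<close>

lemma bilat_step_Suc:
  fixes l a s t :: "int fps"
  defines "Q \<equiv> l * fps_X"
  defines "r \<equiv> (\<lambda>n. rinv (1 - t * fps_X * Q ^ n))"
  defines "G \<equiv> (1 - s * fps_X) * (1 - t * fps_X)"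
  defines "K \<equiv> (\<lambda>n. - G * a * s * fps_X * Q ^ n * r n * bilat l a s t n)"
  assumes t: "t = a * s"
  shows "G * bilat l a s t (Suc n) - (1 - s * t * fps_X\<^sup>2) * bilat l a (Q * s) (Q * t) (Suc n)
       = K (Suc n) - K n"
proof -
  define x where "x = Q ^ Suc n"
  define y where "y = G * a * Q ^ n * r n * bilat l a s t n"
  have R: "r (Suc n) = 1 + t * fps_X * x * r (Suc n)"
    using rinv_one_minus_X[of t x] by (simp add: r_def x_def algebra_simps)
  have E: "bilat l a s t (Suc n) = bilat l a s t n * a * Q ^ n * (s * fps_X - x) * r n"
    by (simp add: Q_def r_def x_def algebra_simps)
  have shift: "bilat l a (Q * s) (Q * t) (Suc n) = - (y * x * r (Suc n))"
  proof -
    have "bilat l a (Q * s) (Q * t) (Suc n) =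
        - (1 - s * fps_X) * (1 - t * fps_X) * a * Q ^ (2 * n + 1) * r (Suc n) * r n * bilat l a s t n"
      unfolding Q_def r_def by (rule bilat_shift_Suc)
    also have "\<dots> = - (y * x * r (Suc n))"
      by (simp add: y_def x_def G_def algebra_simps power_add mult_2_right)
    finally show ?thesis .
  qed
  have "G * bilat l a s t (Suc n) - (1 - s * t * fps_X\<^sup>2) * bilat l a (Q * s) (Q * t) (Suc n)
      - (K (Suc n) - K n)
     = y * ((s * fps_X - x) + (1 - s * t * fps_X\<^sup>2) * x * r (Suc n)
          + a * s * fps_X * x * r (Suc n) * (s * fps_X - x) - s * fps_X)"
    unfolding K_def shift unfolding E y_def x_def[symmetric] by (simp add: algebra_simps)
  \<comment> \<open>By \<open>t = a * s\<close> the bracket collapses to a multiple of the relation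
    \<open>R\<close> that defines the inverse \<open>r (Suc n)\<close>.\<close>
  also have "(s * fps_X - x) + (1 - s * t * fps_X\<^sup>2) * x * r (Suc n)
          + a * s * fps_X * x * r (Suc n) * (s * fps_X - x) - s * fps_X
          = - x * (1 + t * fps_X * x * r (Suc n) - r (Suc n))"
    unfolding t by (simp add: algebra_simps power2_eq_square)
  also have "\<dots> = 0"
    by (subst R[symmetric]) simp
  finally show ?thesis by simp
qed

definition bilat_sum :: "int fps \<Rightarrow> int fps \<Rightarrow> int fps \<Rightarrow> int fps \<Rightarrow> nat \<Rightarrow> int fps" where
  "bilat_sum l a s t N = (\<Sum>n<N. bilat l a s t n) + (\<Sum>n<N. bilat l a t s n) - 1"

text \<open>The telescoped sum leaves \<open>K N\<close>, which has order greater than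
  \<open>N\<close>, and a boundary term from index 0, where the relation for \<open>Suc n\<close>
  does not apply.\<close>

lemma bilat_half_shift:
  fixes l a s t :: "int fps"
  defines "Q \<equiv> l * fps_X"
  assumes t: "t = a * s"
  shows "fps_eq_upto (Suc N)
           ((1 - s * fps_X) * (1 - t * fps_X) * (\<Sum>n<Suc N. bilat l a s t n)
             - (1 - s * t * fps_X\<^sup>2) * (\<Sum>n<Suc N. bilat l a (Q * s) (Q * t) n))
           (- s * fps_X * (1 - t * fps_X))"
proof -
  define G where "G = (1 - s * fps_X) * (1 - t * fps_X)"
  define r where "r n = rinv (1 - t * fps_X * Q ^ n)" for n
  define K where "K n = - G * a * s * fps_X * Q ^ n * r n * bilat l a s t n" for n
  define D where "D n = G * bilat l a s t n - (1 - s * t * fps_X\<^sup>2) * bilat l a (Q * s) (Q * t) n"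
    for n
  have D_Suc: "D (Suc n) = K (Suc n) - K n" for n
    using bilat_step_Suc[of t a s l n, folded Q_def, OF t]
    by (simp add: D_def K_def G_def r_def)
  have r0: "(1 - t * fps_X) * r 0 = 1"
    using rinv_one_minus_X[of t 1] by (simp add: r_def)
  have "K 0 = - (1 - s * fps_X) * a * s * fps_X * ((1 - t * fps_X) * r 0)"
    by (simp add: K_def G_def algebra_simps)
  then have K0: "K 0 = - (1 - s * fps_X) * t * fps_X"
    unfolding r0 by (simp add: t)
  have D0: "D 0 = K 0 - s * fps_X * (1 - t * fps_X)"
    unfolding K0 by (simp add: D_def G_def algebra_simps power2_eq_square)
  have sum: "(\<Sum>n<Suc N. D n) = K N - s * fps_X * (1 - t * fps_X)" for N
    by (induction N) (simp_all add: D0 D_Suc)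
  have "fps_X ^ Suc N dvd K N"
    using X_power_dvd_bilat[of N l a s t] unfolding K_def by (auto elim!: dvdE)
  moreover have "(\<Sum>n<Suc N. D n) = G * (\<Sum>n<Suc N. bilat l a s t n)
             - (1 - s * t * fps_X\<^sup>2) * (\<Sum>n<Suc N. bilat l a (Q * s) (Q * t) n)"
    unfolding D_def sum_subtractf sum_distrib_left ..
  ultimately show ?thesis
    using sum[of N] unfolding fps_eq_upto_iff_dvd G_def by simp
qed

text \<open>With \<open>S = s * fps_X\<close> and \<open>T = t * fps_X\<close>, the boundary terms
  \<open>- S * (1 - T)\<close> and \<open>- T * (1 - S)\<close> of the two halves add up to
  \<open>(1 - S) * (1 - T) - (1 - S * T)\<close>. This is exactly what the \<open>- 1\<close> in
  \<open>bilat_sum\<close> contributes, so the shift becomes homogeneous.\<close>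

lemma bilat_sum_shift:
  fixes l a s t :: "int fps"
  defines "Q \<equiv> l * fps_X"
  assumes t: "t = a * s" and s: "s = a * t"
  shows "fps_eq_upto N
           ((1 - s * fps_X) * (1 - t * fps_X) * bilat_sum l a s t N)
           ((1 - s * t * fps_X\<^sup>2) * bilat_sum l a (Q * s) (Q * t) N)"
proof (cases N)
  case 0
  then show ?thesis by (simp add: fps_eq_upto_def)
next
  case (Suc M)
  define S where "S s t = (\<Sum>n<N. bilat l a s t n)" for s t
  have 1: "fps_eq_upto N ((1 - s * fps_X) * (1 - t * fps_X) * S s t
      - (1 - s * t * fps_X\<^sup>2) * S (Q * s) (Q * t)) (- s * fps_X * (1 - t * fps_X))"
    using bilat_half_shift[OF t, of M l] by (simp add: S_def Q_def Suc)
  have 2: "fps_eq_upto N ((1 - t * fps_X) * (1 - s * fps_X) * S t s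
      - (1 - t * s * fps_X\<^sup>2) * S (Q * t) (Q * s)) (- t * fps_X * (1 - s * fps_X))"
    using bilat_half_shift[OF s, of M l] by (simp add: S_def Q_def Suc)
  show ?thesis
    using fps_eq_upto_add[OF 1 2]
    unfolding fps_eq_upto_iff_dvd bilat_sum_def S_def
    by (simp add: algebra_simps power2_eq_square)
qed

lemma bilat_sum_shift_power:
  fixes l a s t :: "int fps"
  defines "Q \<equiv> l * fps_X"
  assumes t: "t = a * s" and s: "s = a * t"
  shows "fps_eq_upto N
           ((\<Prod>j<J. (1 - s * fps_X * Q ^ j) * (1 - t * fps_X * Q ^ j)) * bilat_sum l a s t N)
           ((\<Prod>j<J. 1 - s * t * fps_X\<^sup>2 * Q ^ (2 * j)) * bilat_sum l a (Q ^ J * s) (Q ^ J * t) N)"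
proof (induction J)
  case (Suc J)
  let ?L = "\<lambda>j. (1 - s * fps_X * Q ^ j) * (1 - t * fps_X * Q ^ j)"
  let ?R = "\<lambda>j. 1 - s * t * fps_X\<^sup>2 * Q ^ (2 * j)"
  have "(\<Prod>j<Suc J. ?L j) * bilat_sum l a s t N = ?L J * ((\<Prod>j<J. ?L j) * bilat_sum l a s t N)"
    by (simp add: mult_ac)
  also have "fps_eq_upto N \<dots> (?L J * ((\<Prod>j<J. ?R j) * bilat_sum l a (Q ^ J * s) (Q ^ J * t) N))"
    by (rule fps_eq_upto_mult[OF fps_eq_upto_refl Suc])
  also have "\<dots> = (\<Prod>j<J. ?R j) * ((1 - (Q ^ J * s) * fps_X) * (1 - (Q ^ J * t) * fps_X)
      * bilat_sum l a (Q ^ J * s) (Q ^ J * t) N)"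
    by (simp add: mult_ac)
  also have "fps_eq_upto N \<dots> ((\<Prod>j<J. ?R j) * ((1 - (Q ^ J * s) * (Q ^ J * t) * fps_X\<^sup>2)
      * bilat_sum l a (Q * (Q ^ J * s)) (Q * (Q ^ J * t)) N))"
    \<comment> \<open>The relations between \<open>s\<close> and \<open>t\<close> survive
      multiplication by \<open>Q ^ J\<close>, so the shift applies again.\<close>
    unfolding Q_def
    by (rule fps_eq_upto_mult[OF fps_eq_upto_refl bilat_sum_shift])
       (subst t, simp only: mult.left_commute, subst s, simp only: mult.left_commute)
  also have "\<dots> = (\<Prod>j<Suc J. ?R j) * bilat_sum l a (Q ^ Suc J * s) (Q ^ Suc J * t) N"
    by (simp add: mult_ac mult_2_right power_add)
  finally show ?case .
qed simp

text \<open>With \<open>s\<close> and \<open>t\<close> negligible, the factor of index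
  \<open>j\<close> is \<open>- a * Q^(2*j+1)\<close>, and the first \<open>n\<close> odd numbers add
  up to \<open>n^2\<close>.\<close>

lemma bilat_limit:
  assumes "fps_X ^ N dvd s" "fps_X ^ N dvd t"
  shows "fps_eq_upto N (bilat l a s t n) ((- a) ^ n * (l * fps_X) ^ n\<^sup>2)"
proof (induction n)
  case (Suc n)
  define Q where "Q = l * fps_X"
  define r where "r = rinv (1 - t * fps_X * Q ^ n)"
  have "r = 1 + t * fps_X * Q ^ n * r"
    using rinv_one_minus_X[of t "Q ^ n"] by (simp add: r_def algebra_simps)
  then have "r - 1 = t * (fps_X * Q ^ n * r)"
    by (simp add: algebra_simps)
  then have r: "fps_eq_upto N r 1"
    unfolding fps_eq_upto_iff_dvd using assms(2) by auto
  have s: "fps_eq_upto N (s - l * Q ^ n) (- l * Q ^ n)"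
    unfolding fps_eq_upto_iff_dvd using assms(1) by simp
  have "fps_eq_upto N (bilat l a s t n * a * Q ^ n * fps_X * (s - l * Q ^ n) * r)
      ((- a) ^ n * Q ^ n\<^sup>2 * a * Q ^ n * fps_X * (- l * Q ^ n) * 1)"
    by (intro fps_eq_upto_mult r s Suc[folded Q_def]) auto
  also have "((- a) ^ n * Q ^ n\<^sup>2 * a * Q ^ n * fps_X * (- l * Q ^ n) * 1)
      = (- a) ^ Suc n * Q ^ (Suc n)\<^sup>2"
    by (simp add: power2_eq_square power_add Q_def mult_ac)
  finally show ?case
    by (simp add: r_def Q_def)
qed simp

text \<open>After \<open>N\<close> shifts both parameters are divisible by \<open>fps_X ^ N\<close>,
  and each half of the sum becomes a truncated partial theta series.\<close>

lemma bilat_sum_product: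
  fixes l a s t :: "int fps" and N :: nat
  defines "Q \<equiv> l * fps_X"
  assumes t: "t = a * s" and s: "s = a * t" and N: "N > 0"
  shows "fps_eq_upto N
           ((\<Prod>j<N. (1 - s * fps_X * Q ^ j) * (1 - t * fps_X * Q ^ j)) * bilat_sum l a s t N)
           ((\<Prod>j<N. 1 - s * t * fps_X\<^sup>2 * Q ^ (2 * j)) * (1 + 2 * (\<Sum>n=1..<N. (- a) ^ n * Q ^ n\<^sup>2)))"
proof -
  have d: "fps_X ^ N dvd Q ^ N * x" for x
    by (simp add: Q_def power_mult_distrib)
  have "fps_eq_upto N (bilat_sum l a (Q ^ N * s) (Q ^ N * t) N)
      ((\<Sum>n<N. (- a) ^ n * Q ^ n\<^sup>2) + (\<Sum>n<N. (- a) ^ n * Q ^ n\<^sup>2) - 1)"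
    unfolding bilat_sum_def unfolding Q_def
    by (intro fps_eq_upto_diff fps_eq_upto_add fps_eq_upto_sum bilat_limit fps_eq_upto_refl
        d[unfolded Q_def])
  also have "(\<Sum>n<N. (- a) ^ n * Q ^ n\<^sup>2) = 1 + (\<Sum>n=1..<N. (- a) ^ n * Q ^ n\<^sup>2)"
    using N by (simp add: lessThan_atLeast0 sum.atLeast_Suc_lessThan)
  finally have lim: "fps_eq_upto N (bilat_sum l a (Q ^ N * s) (Q ^ N * t) N)
      (1 + 2 * (\<Sum>n=1..<N. (- a) ^ n * Q ^ n\<^sup>2))"
    by (simp add: algebra_simps)
  show ?thesis
    using bilat_sum_shift_power[OF t s, where J = N and N = N and l = l, folded Q_def] fps_eq_upto_mult[OF fps_eq_upto_refl lim]
    by (rule fps_eq_upto_trans)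
qed

section \<open>Gauss' product for the theta series\<close>

definition theta :: "int fps" where
  "theta = Abs_fps (\<lambda>n. if n = 0 then 1 else if is_square n then 2 else 0)"

definition theta_neg :: "int fps" where
  "theta_neg = theta oo - fps_X"

lemma theta_nth: "fps_nth theta n = (if n = 0 then 1 else if is_square n then 2 else 0)"
  by (simp add: theta_def)

lemma theta_neg_nth: "fps_nth theta_neg n = (- 1) ^ n * fps_nth theta n"
  by (simp add: theta_neg_def)

lemma theta_neg_compose: "theta_neg oo - fps_X = theta"
  by (rule fps_ext) (simp add: theta_neg_nth flip: power_mult_distrib mult.assoc)

lemma theta_upto: "fps_eq_upto N (1 + 2 * (\<Sum>n=1..<N. fps_X ^ n\<^sup>2)) theta"
  unfolding fps_eq_upto_def
proof safe
  fix i assume i: "i < N"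
  have *: "fps_nth (\<Sum>n=1..<N. fps_X ^ n\<^sup>2 :: int fps) i
      = (\<Sum>n\<in>{1..<N} \<inter> {n. i = n\<^sup>2}. 1)"
    by (simp add: fps_sum_nth sum.If_cases)
  have "fps_nth (1 + 2 * (\<Sum>n=1..<N. fps_X ^ n\<^sup>2) :: int fps) i
      = (if i = 0 then 1 else 0) + 2 * fps_nth (\<Sum>n=1..<N. fps_X ^ n\<^sup>2 :: int fps) i"
    by (simp add: numeral_fps_const)
  also have "\<dots> = fps_nth theta i"
  proof (cases "i > 0 \<and> is_square i")
    case True
    then obtain k where k: "i = k\<^sup>2" by (auto elim!: is_nth_powerE)
    have "k \<le> k\<^sup>2" by (simp add: power2_eq_square)
    with i k True have "{1..<N} \<inter> {n. i = n\<^sup>2} = {k}" by (auto simp: Suc_le_eq)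
    then show ?thesis using True unfolding * by (simp add: theta_nth)
  next
    case False
    then have "{1..<N} \<inter> {n. i = n\<^sup>2} = {}" by auto
    then show ?thesis using False unfolding * by (auto simp: theta_nth)
  qed
  finally show "fps_nth (1 + 2 * (\<Sum>n=1..<N. fps_X ^ n\<^sup>2)) i = fps_nth theta i" .
qed

lemma fps_prod_nth_0: "fps_nth (\<Prod>x\<in>S. f x) 0 = (\<Prod>x\<in>S. fps_nth (f x) 0)"
  for f :: "'a \<Rightarrow> int fps"
  by (induction S rule: infinite_finite_induct) simp_all

lemmas fps_compose_distribs =
  fps_compose_add_distrib fps_compose_sub_distrib fps_compose_uminus fps_compose_mult_distrib
  fps_compose_prod_distrib fps_compose_sum_distrib fps_compose_power[symmetric]

lemma uminus_X_power_square: "(- fps_X :: int fps) ^ n\<^sup>2 = (- 1) ^ n * fps_X ^ n\<^sup>2"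
  by (cases "even n") simp_all

lemma numeral_2_compose: "(2 :: int fps) oo f = 2"
  by (simp add: numeral_fps_const)

lemma theta_neg_upto: "fps_eq_upto N (1 + 2 * (\<Sum>n=1..<N. (- 1) ^ n * fps_X ^ n\<^sup>2)) theta_neg"
proof -
  have "(1 + 2 * (\<Sum>n=1..<N. fps_X ^ n\<^sup>2)) oo - fps_X
      = 1 + 2 * (\<Sum>n=1..<N. (- 1) ^ n * fps_X ^ n\<^sup>2 :: int fps)"
    by (simp add: fps_compose_distribs uminus_X_power_square numeral_2_compose)
  then show ?thesis
    using fps_eq_upto_compose_uminus_X[OF theta_upto[of N]] by (simp add: theta_neg_def)
qed

text \<open>With all parameters equal to 1 the factor \<open>s - l\<close> at index 0 kills every
  later term, so the two-sided sum is 1. Its product evaluation is then Gauss' formula multiplied by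
  one more copy of the left-hand product, which cancels.\<close>

lemma gauss_theta_neg_product:
  "fps_eq_upto N (\<Prod>j<N. 1 - fps_X ^ Suc j) ((\<Prod>j<N. 1 + fps_X ^ Suc j) * theta_neg)"
proof (cases "N = 0")
  case True
  then show ?thesis by (simp add: fps_eq_upto_def)
next
  case False
  let ?P = "\<Prod>j<N. 1 - fps_X ^ Suc j :: int fps"
  let ?Q = "\<Prod>j<N. 1 + fps_X ^ Suc j :: int fps"
  have zero: "bilat 1 1 1 1 (Suc n) = 0" for n
    by (induction n) simp_all
  have "(\<Sum>n<N. bilat 1 1 1 1 n) = (\<Sum>n\<in>{0}. bilat 1 1 1 1 n)"
  proof (rule sum.mono_neutral_right)
    show "\<forall>n\<in>{..<N} - {0}. bilat 1 1 1 1 n = 0"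
      by (metis DiffE insertI1 not0_implies_Suc zero)
  qed (use False in auto)
  then have sum: "bilat_sum 1 1 1 1 N = 1"
    by (simp add: bilat_sum_def)
  have P: "(\<Prod>j<N. (1 - 1 * fps_X * (1 * fps_X) ^ j) * (1 - 1 * fps_X * (1 * fps_X) ^ j)) = ?P * ?P"
    by (simp add: prod.distrib)
  have Q: "(\<Prod>j<N. 1 - 1 * 1 * fps_X\<^sup>2 * (1 * fps_X) ^ (2 * j)) = ?Q * ?P"
    unfolding prod.distrib[symmetric]
    by (intro prod.cong) (simp_all add: algebra_simps power2_eq_square mult_2_right power_add)
  have "fps_eq_upto N (?P * ?P) (?Q * ?P * (1 + 2 * (\<Sum>n=1..<N. (- 1) ^ n * fps_X ^ n\<^sup>2)))"
    using bilat_sum_product[of 1 1 1 N 1] False unfolding P Q sum by simp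
  also have "fps_eq_upto N \<dots> (?Q * ?P * theta_neg)"
    by (rule fps_eq_upto_mult[OF fps_eq_upto_refl theta_neg_upto])
  also have "\<dots> = ?Q * theta_neg * ?P"
    by simp
  finally show ?thesis
    by (rule fps_eq_upto_cong_mult_right) (simp add: fps_prod_nth_0)
qed

section \<open>Products over odd and even exponents\<close>

definition prod_odd :: "int \<Rightarrow> nat \<Rightarrow> int fps" where
  "prod_odd c N = (\<Prod>j<N. 1 + fps_const c * fps_X ^ (2 * j + 1))"

definition prod_even :: "int \<Rightarrow> nat \<Rightarrow> int fps" where
  "prod_even c N = (\<Prod>j<N. 1 + fps_const c * fps_X ^ (2 * j + 2))"

lemma prod_odd_nth_0 [simp]: "fps_nth (prod_odd c N) 0 = 1"
  by (simp add: prod_odd_def fps_prod_nth_0)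

lemma prod_even_nth_0 [simp]: "fps_nth (prod_even c N) 0 = 1"
  by (simp add: prod_even_def fps_prod_nth_0)

lemma prod_upto_double:
  "(\<Prod>j<2*N. 1 + fps_const c * fps_X ^ Suc j) = prod_odd c N * prod_even c N"
  by (induction N) (simp_all add: prod_odd_def prod_even_def mult_ac)

lemma prod_compose_X2:
  "(\<Prod>j<N. 1 + fps_const c * fps_X ^ Suc j) oo fps_X ^ 2 = prod_even c N"
  by (simp add: prod_even_def fps_compose_distribs
      power_mult[symmetric] del: power_Suc)

lemma prod_odd_compose_uminus: "prod_odd c N oo - fps_X = prod_odd (- c) N"
  by (simp add: prod_odd_def fps_compose_distribs
      flip: fps_const_neg)

text \<open>Gauss' product of length \<open>2 * N\<close> splits into odd and even exponents. The
  even part is Gauss' product in \<open>q^2\<close>, which brings in \<open>M(q^2)\<close>.\<close>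

lemma theta_neg_product:
  "fps_eq_upto (2 * N) (theta_neg * prod_odd 1 N) ((theta_neg oo fps_X\<^sup>2) * prod_odd (- 1) N)"
proof -
  have 1: "fps_eq_upto (2 * N) (prod_odd (- 1) N * prod_even (- 1) N)
      (prod_odd 1 N * prod_even 1 N * theta_neg)"
    using gauss_theta_neg_product[of "2 * N"] prod_upto_double[of "-1" N] prod_upto_double[of 1 N]
    by (simp flip: fps_const_neg)
  have "fps_eq_upto (2 * N) (prod_even (- 1) N) (prod_even 1 N * (theta_neg oo fps_X\<^sup>2))"
    using fps_eq_upto_compose_X_power[OF gauss_theta_neg_product[of N], of 2]
      prod_compose_X2[of "-1" N] prod_compose_X2[of 1 N]
    by (simp add: fps_compose_mult_distrib flip: fps_const_neg)
  from fps_eq_upto_mult[OF fps_eq_upto_refl this] have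
    2: "fps_eq_upto (2 * N) (prod_odd (- 1) N * prod_even (- 1) N)
      (prod_odd (- 1) N * (prod_even 1 N * (theta_neg oo fps_X\<^sup>2)))" .
  have "fps_eq_upto (2 * N) (theta_neg * prod_odd 1 N * prod_even 1 N)
     ((theta_neg oo fps_X\<^sup>2) * prod_odd (- 1) N * prod_even 1 N)"
    using fps_eq_upto_trans[OF fps_eq_upto_sym[OF 1] 2] by (simp add: mult_ac)
  then show ?thesis
    by (rule fps_eq_upto_cong_mult_right) simp
qed

text \<open>This is the previous relation under \<open>q -> -q\<close>, which exchanges
  \<open>P\<close> and \<open>M\<close> as well as the two odd products and fixes
  \<open>M(q^2)\<close>.\<close>

lemma theta_product:
  "fps_eq_upto (2 * N) (theta * prod_odd (- 1) N) ((theta_neg oo fps_X\<^sup>2) * prod_odd 1 N)"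
proof -
  have "(theta_neg oo fps_X\<^sup>2) oo - fps_X = theta_neg oo fps_X\<^sup>2"
    by (rule fps_ext) (auto simp: fps_compose_X_power_nth)
  then show ?thesis
    using fps_eq_upto_compose_uminus_X[OF theta_neg_product[of N]]
    by (simp add: fps_compose_mult_distrib theta_neg_compose prod_odd_compose_uminus)
qed

text \<open>Multiplying the two preceding relations, the odd products appear on both sides and
  cancel: \<open>P * M = M(q^2)^2\<close>.\<close>

lemma theta_mult_theta_neg: "theta * theta_neg = (theta_neg oo fps_X\<^sup>2)\<^sup>2"
proof (rule fps_eqI_upto)
  fix N
  let ?D = "theta_neg oo fps_X\<^sup>2"
  have "fps_eq_upto (2 * N) (theta * prod_odd (- 1) N * (theta_neg * prod_odd 1 N))
      (?D * prod_odd 1 N * (?D * prod_odd (- 1) N))"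
    by (rule fps_eq_upto_mult[OF theta_product theta_neg_product])
  then have "fps_eq_upto (2 * N) (theta * theta_neg * (prod_odd (- 1) N * prod_odd 1 N))
      (?D\<^sup>2 * (prod_odd (- 1) N * prod_odd 1 N))"
    by (simp add: mult_ac power2_eq_square)
  then have "fps_eq_upto (2 * N) (theta * theta_neg) (?D\<^sup>2)"
    by (rule fps_eq_upto_cong_mult_right) simp
  then show "fps_eq_upto N (theta * theta_neg) (?D\<^sup>2)"
    by (rule fps_eq_upto_mono) simp
qed

section \<open>The two-dissection of the generating function\<close>

lemma rinv_mult:
  assumes "fps_nth f 0 = 1" "fps_nth g 0 = 1"
  shows "rinv (f * g) = rinv f * rinv g"
proof -
  have "f * g * (rinv f * rinv g) = (f * rinv f) * (g * rinv g)"
    by (simp only: mult_ac)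
  then show ?thesis
    by (intro rinv_unique[symmetric]) (simp_all add: rinv assms)
qed

lemma rinv_compose:
  assumes "fps_nth f 0 = 1" "fps_nth g 0 = 0"
  shows "rinv f oo g = rinv (f oo g)"
proof (rule rinv_unique)
  show "(f oo g) * (rinv f oo g) = 1"
    by (simp add: fps_compose_mult_distrib[OF assms(2), symmetric] rinv assms)
qed (simp add: assms fps_compose_nth)

lemma qpochhammer_Suc: "qpochhammer a q (Suc n) = qpochhammer a q n * (1 - a * q ^ n)"
  by (simp add: qpochhammer_def)

text \<open>For these parameters the factor of index \<open>j\<close> is
  \<open>q^(2*j+1) * (1 + q^(2*j+1)) / (1 - q^(2*j+1))\<close>.\<close>

lemma v0_term_eq_bilat: "v0_term n = bilat fps_X (- 1) (- 1) 1 n"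
proof (induction n)
  case 0
  have "rinv 1 = 1"
    by (rule rinv_unique[symmetric]) simp_all
  then show ?case by (simp add: v0_term_def qpochhammer_def)
next
  case (Suc n)
  let ?q = "fps_X\<^sup>2 :: int fps"
  have q: "(fps_X * fps_X :: int fps) = ?q"
    by (simp add: power2_eq_square)
  have inv: "rinv (qpochhammer fps_X ?q (Suc n)) = rinv (qpochhammer fps_X ?q n) * rinv (1 - fps_X * ?q ^ n)"
    unfolding qpochhammer_Suc by (rule rinv_mult) (simp_all add: qpochhammer_fps_X_nth_0)
  have "(Suc n)\<^sup>2 = n\<^sup>2 + 2 * n + 1"
    by (simp add: power2_eq_square)
  then have X: "fps_X ^ (Suc n)\<^sup>2 = fps_X ^ n\<^sup>2 * ?q ^ n * (fps_X :: int fps)"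
    by (simp only: power_add power_mult power_one_right)
  have "v0_term (Suc n) = v0_term n * (?q ^ n * fps_X * (1 + fps_X * ?q ^ n) * rinv (1 - fps_X * ?q ^ n))"
    unfolding v0_term_def inv X qpochhammer_Suc[of "- fps_X"] by (simp add: mult_ac)
  also have "\<dots> = bilat fps_X (- 1) (- 1) 1 (Suc n)"
    unfolding Suc.IH bilat.simps q by (simp add: algebra_simps)
  finally show ?case .
qed

text \<open>The base \<open>q^2\<close> is fixed by \<open>q -> -q\<close>, while numerators and
  denominators trade signs; this exchanges \<open>s\<close> and \<open>t\<close>.\<close>

lemma v0_term_compose_uminus: "v0_term n oo - fps_X = bilat fps_X (- 1) 1 (- 1) n"
  unfolding v0_term_eq_bilat
proof (induction n)
  case (Suc n)
  define z :: "int fps" where "z = (fps_X * fps_X) ^ n"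
  have z: "z oo - fps_X = z"
    by (simp add: z_def fps_compose_distribs)
  have inv: "rinv (1 - 1 * fps_X * z) oo - fps_X = rinv (1 - (- 1) * fps_X * z)"
    by (subst rinv_compose) (simp_all add: fps_compose_distribs z)
  show ?case
    unfolding bilat.simps z_def[symmetric] fps_compose_mult_distrib[of "- fps_X", simplified] inv Suc
    by (simp add: fps_compose_distribs z algebra_simps)
qed simp

text \<open>Terms of index above \<open>m\<close> do not reach the coefficient \<open>m\<close>, so
  it is constant along all longer partial sums and equals its limit.\<close>

lemma v0_gf_nth:
  assumes "m < N"
  shows "fps_nth v0_gf m = fps_nth (\<Sum>n<N. v0_term n) m"
proof -
  have "\<forall>\<^sub>F N in sequentially. fps_nth (\<Sum>n<N. v0_term n) m = fps_nth v0_gf m"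
    using v0_term_sums unfolding sums_def tendsto_fps_iff by blast
  then obtain M where M: "\<And>N. N \<ge> M \<Longrightarrow> fps_nth (\<Sum>n<N. v0_term n) m = fps_nth v0_gf m"
    unfolding eventually_sequentially by blast
  have "fps_nth (\<Sum>n<max M N. v0_term n) m = fps_nth (\<Sum>n<N. v0_term n) m"
    unfolding fps_sum_nth
    by (rule sum.mono_neutral_right) (use assms v0_term_nth_eq_0 in auto)
  with M[of "max M N"] show ?thesis
    by simp
qed

text \<open>The halves of the two-sided sum are \<open>F(q)\<close> and \<open>F(-q)\<close>, and
  the term 1 of index 0 occurs in both.\<close>

definition v0_sym :: "int fps" where
  "v0_sym = v0_gf + (v0_gf oo - fps_X) - 1"

lemma v0_sym_upto: "fps_eq_upto N (bilat_sum fps_X (- 1) (- 1) 1 N) v0_sym"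
proof -
  have 1: "fps_eq_upto N (\<Sum>n<N. v0_term n) v0_gf"
    by (simp add: fps_eq_upto_def v0_gf_nth)
  have 2: "fps_eq_upto N (\<Sum>n<N. v0_term n oo - fps_X) (v0_gf oo - fps_X)"
    using fps_eq_upto_compose_uminus_X[OF 1] by (simp add: fps_compose_sum_distrib)
  show ?thesis
    using fps_eq_upto_diff[OF fps_eq_upto_add[OF 1 2] fps_eq_upto_refl]
    by (simp add: v0_sym_def bilat_sum_def v0_term_eq_bilat[symmetric] v0_term_compose_uminus[symmetric])
qed

lemma compose_X2_X2: "f oo fps_X\<^sup>2 oo fps_X\<^sup>2 = f oo (fps_X ^ 4 :: int fps)"
proof (rule fps_ext)
  fix n :: nat
  have "4 dvd n \<longleftrightarrow> 2 dvd n \<and> 2 dvd n div 2"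
    by presburger
  then show "fps_nth (f oo fps_X\<^sup>2 oo fps_X\<^sup>2) n = fps_nth (f oo fps_X ^ 4) n"
    by (simp add: fps_compose_X_power_nth flip: div_mult2_eq)
qed

text \<open>Here the base is \<open>q^2\<close>. The left factors pair up as
  \<open>(1 + y j) * (1 - y j)\<close>, which gives products in \<open>q^2\<close>, and
  \<open>a = -1\<close> removes the signs from the theta series.\<close>

lemma v0_sym_product:
  assumes "N > 0"
  shows "fps_eq_upto N (v0_sym * (prod_odd (- 1) N oo fps_X\<^sup>2))
           ((prod_odd 1 N oo fps_X\<^sup>2) * (theta oo fps_X\<^sup>2))"
proof -
  let ?S = "1 + 2 * (\<Sum>n=1..<N. fps_X ^ n\<^sup>2) :: int fps"
  define y :: "nat \<Rightarrow> int fps" where "y j = fps_X * (fps_X * fps_X) ^ j" for j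
  have "(x\<^sup>2) ^ (2 * j + 1) = (x * (x * x) ^ j)\<^sup>2" for x :: "int fps" and j
    by (simp add: power2_eq_square power_mult_distrib mult_2 mult_2_right power_add mult_ac)
  then have y: "(fps_X\<^sup>2) ^ (2 * j + 1) = (y j)\<^sup>2" for j
    by (simp only: y_def)
  have comp: "(1 + fps_const c * fps_X ^ (2 * j + 1)) oo fps_X\<^sup>2 = 1 + fps_const c * (y j)\<^sup>2" for c j
    unfolding y[symmetric]
    by (simp add: fps_compose_add_distrib fps_compose_mult_distrib fps_compose_power[symmetric]
        del: power_Suc)
  have L: "(\<Prod>j<N. (1 - (- 1) * fps_X * (fps_X * fps_X) ^ j) * (1 - 1 * fps_X * (fps_X * fps_X) ^ j))
      = prod_odd (- 1) N oo fps_X\<^sup>2"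
    unfolding prod_odd_def fps_compose_prod_distrib[of "fps_X\<^sup>2", simplified] comp
    unfolding mult.assoc y_def[symmetric]
    by (intro prod.cong) (simp_all add: algebra_simps power2_eq_square flip: fps_const_neg)
  have "x\<^sup>2 * (x * x) ^ (2 * j) = (x * (x * x) ^ j)\<^sup>2" for x :: "int fps" and j
    by (simp add: power2_eq_square power_mult_distrib mult_2 mult_2_right power_add mult_ac)
  then have "fps_X\<^sup>2 * (fps_X * fps_X) ^ (2 * j) = (y j)\<^sup>2" for j
    by (simp only: y_def)
  then have R: "(\<Prod>j<N. 1 - (- 1) * 1 * fps_X\<^sup>2 * (fps_X * fps_X) ^ (2 * j)) = prod_odd 1 N oo fps_X\<^sup>2"
    unfolding prod_odd_def fps_compose_prod_distrib[of "fps_X\<^sup>2", simplified] comp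
    by (intro prod.cong) (simp_all add: mult.assoc)
  have S: "1 + 2 * (\<Sum>n=1..<N. (- (- 1)) ^ n * (fps_X * fps_X) ^ n\<^sup>2) = ?S oo fps_X\<^sup>2"
    by (simp add: fps_compose_distribs numeral_2_compose power2_eq_square)
  have "fps_eq_upto N ((prod_odd (- 1) N oo fps_X\<^sup>2) * bilat_sum fps_X (- 1) (- 1) 1 N)
      ((prod_odd 1 N oo fps_X\<^sup>2) * (?S oo fps_X\<^sup>2))"
    using bilat_sum_product[of 1 "-1" "-1" N fps_X] assms unfolding L R S by simp
  moreover have "fps_eq_upto N ((prod_odd (- 1) N oo fps_X\<^sup>2) * bilat_sum fps_X (- 1) (- 1) 1 N)
      ((prod_odd (- 1) N oo fps_X\<^sup>2) * v0_sym)"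
    by (rule fps_eq_upto_mult[OF fps_eq_upto_refl v0_sym_upto])
  moreover have "fps_eq_upto N (?S oo fps_X\<^sup>2) (theta oo fps_X\<^sup>2)"
    by (rule fps_eq_upto_mono[OF fps_eq_upto_compose_X_power[OF theta_upto[of N]]]) auto
  from fps_eq_upto_mult[OF fps_eq_upto_refl this]
  have "fps_eq_upto N ((prod_odd 1 N oo fps_X\<^sup>2) * (?S oo fps_X\<^sup>2))
      ((prod_odd 1 N oo fps_X\<^sup>2) * (theta oo fps_X\<^sup>2))" .
  ultimately show ?thesis
    unfolding mult.commute[of v0_sym] by (blast intro: fps_eq_upto_trans fps_eq_upto_sym)
qed

text \<open>The product formula for \<open>P\<close>, taken at \<open>q^2\<close>, replaces the
  quotient of the two odd products by \<open>P(q^2) / M(q^4)\<close>.\<close>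

lemma v0_sym_theta: "v0_sym * (theta_neg oo fps_X ^ 4) = (theta oo fps_X\<^sup>2)\<^sup>2"
proof (rule fps_eqI_upto)
  fix N
  show "fps_eq_upto N (v0_sym * (theta_neg oo fps_X ^ 4)) ((theta oo fps_X\<^sup>2)\<^sup>2)"
  proof (cases "N = 0")
    case True
    then show ?thesis by (simp add: fps_eq_upto_def)
  next
    case False
    let ?O = "\<lambda>c. prod_odd c N oo fps_X\<^sup>2"
    let ?T = "theta oo fps_X\<^sup>2" and ?M = "theta_neg oo fps_X ^ 4"
    have "fps_eq_upto (2 * (2 * N)) ((theta * prod_odd (- 1) N) oo fps_X\<^sup>2)
        (((theta_neg oo fps_X\<^sup>2) * prod_odd 1 N) oo fps_X\<^sup>2)"
      by (rule fps_eq_upto_compose_X_power[OF theta_product]) simp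
    then have "fps_eq_upto (2 * (2 * N)) (?T * ?O (- 1)) (?M * ?O 1)"
      unfolding fps_compose_mult_distrib[of "fps_X\<^sup>2", simplified] compose_X2_X2 .
    then have 2: "fps_eq_upto N (?T * ?O (- 1)) (?M * ?O 1)"
      by (rule fps_eq_upto_mono) simp
    have "fps_eq_upto N (v0_sym * ?O (- 1) * ?M) (?O 1 * ?T * ?M)"
      by (rule fps_eq_upto_mult[OF v0_sym_product fps_eq_upto_refl]) (use False in simp)
    also have "?O 1 * ?T * ?M = ?T * (?M * ?O 1)"
      by (simp only: mult_ac)
    also have "fps_eq_upto N \<dots> (?T * (?T * ?O (- 1)))"
      by (rule fps_eq_upto_mult[OF fps_eq_upto_refl fps_eq_upto_sym[OF 2]])
    finally have "fps_eq_upto N (v0_sym * ?M * ?O (- 1)) (?T\<^sup>2 * ?O (- 1))"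
      by (simp only: mult_ac power2_eq_square)
    then show ?thesis
      by (rule fps_eq_upto_cong_mult_right) (simp add: fps_compose_nth)
  qed
qed

section \<open>The four-dissection of the theta series\<close>

definition decimate :: "nat \<Rightarrow> int fps \<Rightarrow> int fps" where
  "decimate k f = Abs_fps (\<lambda>n. fps_nth f (k * n))"

lemma decimate_nth [simp]: "fps_nth (decimate k f) n = fps_nth f (k * n)"
  by (simp add: decimate_def)

lemma decimate_add: "decimate k (f + g) = decimate k f + decimate k g"
  by (rule fps_ext) simp

lemma decimate_sum: "decimate k (\<Sum>x\<in>S. f x) = (\<Sum>x\<in>S. decimate k (f x))"
  by (rule fps_ext) (simp add: fps_sum_nth)

lemma decimate_of_nat_mult: "decimate k (of_nat c * f) = of_nat c * decimate k f"
  by (rule fps_ext) (simp flip: fps_of_nat)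

lemma decimate_0 [simp]: "decimate k 0 = 0"
  by (rule fps_ext) simp

text \<open>Only indices divisible by \<open>k\<close> contribute from the second factor, so a
  series in \<open>q^k\<close> can be pulled out of the extraction.\<close>

lemma decimate_mult_compose:
  assumes "k > 0"
  shows "decimate k (f * (g oo fps_X ^ k)) = decimate k f * g"
proof (rule fps_ext)
  fix n
  have "fps_nth (f * (g oo fps_X ^ k)) (k * n)
      = (\<Sum>i=0..k * n. fps_nth f i * (if k dvd k * n - i then fps_nth g ((k * n - i) div k) else 0))"
    by (simp add: fps_mult_nth fps_compose_X_power_nth[OF assms])
  also have "\<dots> = (\<Sum>i\<in>(\<lambda>j. k * j) ` {0..n}. fps_nth f i * fps_nth g ((k * n - i) div k))"
  proof (rule sum.mono_neutral_cong_right)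
    show "\<forall>i\<in>{0..k * n} - (\<lambda>j. k * j) ` {0..n}.
        fps_nth f i * (if k dvd k * n - i then fps_nth g ((k * n - i) div k) else 0) = 0"
    proof
      fix i assume i: "i \<in> {0..k * n} - (\<lambda>j. k * j) ` {0..n}"
      have "\<not> k dvd k * n - i"
      proof
        assume "k dvd k * n - i"
        with i have "k dvd i" by (metis DiffD1 atLeastAtMost_iff dvd_diffD1 dvd_triv_left)
        then obtain j where "i = k * j" ..
        with i assms show False by auto
      qed
      then show "fps_nth f i * (if k dvd k * n - i then fps_nth g ((k * n - i) div k) else 0) = 0"
        by simp
    qed
  qed (use assms in \<open>auto simp flip: diff_mult_distrib2\<close>)
  also have "\<dots> = (\<Sum>j=0..n. fps_nth f (k * j) * fps_nth g (n - j))"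
    by (subst sum.reindex) (use assms in \<open>auto simp: inj_on_def simp flip: diff_mult_distrib2\<close>)
  finally show "fps_nth (decimate k (f * (g oo fps_X ^ k))) n = fps_nth (decimate k f * g) n"
    by (simp add: fps_mult_nth)
qed

lemma decimate_compose: "k > 0 \<Longrightarrow> decimate k (g oo fps_X ^ k) = g"
  by (rule fps_ext) (simp add: fps_compose_X_power_nth)

lemma decimate_funpow_nth: "fps_nth ((decimate k ^^ j) f) n = fps_nth f (k ^ j * n)"
  by (induction j arbitrary: n) (simp_all add: mult_ac)

section \<open>Exponents modulo 4 in the even and odd parts of \<open>P\<close>\<close>

definition supp_mod4 :: "nat \<Rightarrow> int fps \<Rightarrow> bool" where
  "supp_mod4 r f \<longleftrightarrow> (\<forall>n. fps_nth f n \<noteq> 0 \<longrightarrow> [n = r] (mod 4))"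

lemma supp_mod4_mult:
  assumes "supp_mod4 r f" "supp_mod4 s g"
  shows "supp_mod4 (r + s) (f * g)"
  unfolding supp_mod4_def
proof (intro allI impI)
  fix n assume "fps_nth (f * g) n \<noteq> 0"
  then obtain i where i: "i \<le> n" "fps_nth f i * fps_nth g (n - i) \<noteq> 0"
    unfolding fps_mult_nth by (meson atLeastAtMost_iff sum.not_neutral_contains_not_neutral)
  then have "[i = r] (mod 4)" "[n - i = s] (mod 4)"
    using assms by (auto simp: supp_mod4_def)
  then have "[i + (n - i) = r + s] (mod 4)"
    by (rule cong_add)
  with i show "[n = r + s] (mod 4)"
    by simp
qed

lemma supp_mod4_power: "supp_mod4 r f \<Longrightarrow> supp_mod4 (r * k) (f ^ k)"
proof (induction k)
  case 0
  then show ?case by (simp add: supp_mod4_def)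
next
  case (Suc k)
  then show ?case using supp_mod4_mult[of r f "r * k" "f ^ k"] by simp
qed

definition theta_even :: "int fps" where
  "theta_even = theta oo fps_X ^ 4"

definition theta_odd :: "int fps" where
  "theta_odd = Abs_fps (\<lambda>n. if odd n then fps_nth theta n else 0)"

lemma even_square_iff:
  fixes n :: nat
  assumes "even n"
  shows "is_square n \<longleftrightarrow> 4 dvd n \<and> is_square (n div 4)"
proof
  assume "is_square n"
  then obtain k where k: "n = k\<^sup>2" by (auto elim!: is_nth_powerE)
  with assms obtain j where "k = 2 * j" by auto
  with k have "n = 4 * j\<^sup>2" by (simp add: power_mult_distrib)
  then show "4 dvd n \<and> is_square (n div 4)" by simp
next
  assume "4 dvd n \<and> is_square (n div 4)"
  then obtain k where "n = 4 * k\<^sup>2" by (auto elim!: is_nth_powerE)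
  then have "n = (2 * k)\<^sup>2" by (simp add: power_mult_distrib)
  then show "is_square n" by (rule is_nth_powerI)
qed

lemma theta_dissection: "theta = theta_even + theta_odd"
proof (rule fps_ext)
  fix n
  show "fps_nth theta n = fps_nth (theta_even + theta_odd) n"
    using even_square_iff[of n]
    by (cases "odd n") (auto simp: theta_even_def theta_odd_def fps_compose_X_power_nth theta_nth elim: dvdE)
qed

lemma theta_neg_dissection: "theta_neg = theta_even - theta_odd"
proof (rule fps_ext)
  fix n
  have "fps_nth theta n = fps_nth theta_even n + fps_nth theta_odd n"
    by (subst theta_dissection) simp
  moreover have "fps_nth theta_even n = 0" if "odd n"
    using that by (auto simp: theta_even_def fps_compose_X_power_nth)
  ultimately show "fps_nth theta_neg n = fps_nth (theta_even - theta_odd) n"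
    by (cases "odd n") (auto simp: theta_neg_nth theta_odd_def)
qed

lemma theta_even_nth_0 [simp]: "fps_nth theta_even 0 = 1"
  by (simp add: theta_even_def fps_compose_X_power_nth theta_nth)

lemma theta_nth_0 [simp]: "fps_nth theta 0 = 1" and theta_neg_nth_0 [simp]: "fps_nth theta_neg 0 = 1"
  by (simp_all add: theta_neg_nth theta_nth)

lemma supp_mod4_theta_even: "supp_mod4 0 theta_even"
  by (auto simp: supp_mod4_def theta_even_def fps_compose_X_power_nth cong_0_iff)

lemma supp_mod4_theta_odd: "supp_mod4 1 theta_odd"
  unfolding supp_mod4_def
proof (intro allI impI)
  fix n assume "fps_nth theta_odd n \<noteq> 0"
  then have n: "odd n" "is_square n"
    by (auto simp: theta_odd_def theta_nth split: if_splits)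
  then obtain k where k: "n = k\<^sup>2" "odd k" by (auto elim!: is_nth_powerE)
  then obtain j where "k = 2 * j + 1" by (auto elim: oddE)
  with k have "n = 4 * (j\<^sup>2 + j) + 1" by (simp add: power2_eq_square algebra_simps)
  then show "[n = 1] (mod 4)" by (simp add: cong_def)
qed

lemma theta_even_odd_diff: "theta_even\<^sup>2 - theta_odd\<^sup>2 = (theta_neg oo fps_X\<^sup>2)\<^sup>2"
proof -
  have "(theta_neg oo fps_X\<^sup>2)\<^sup>2 = theta * theta_neg"
    by (rule theta_mult_theta_neg[symmetric])
  also have "\<dots> = (theta_even + theta_odd) * (theta_even - theta_odd)"
    by (simp only: theta_neg_dissection theta_dissection[symmetric])
  finally show ?thesis
    by (simp add: algebra_simps power2_eq_square)
qed

text \<open>Replacing \<open>q\<^sup>2\<close> by \<open>- q\<^sup>2\<close> in the previous identity fixes the square of the even part and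
  negates the square of the odd part.\<close>

lemma theta_even_odd_sum: "theta_even\<^sup>2 + theta_odd\<^sup>2 = (theta oo fps_X\<^sup>2)\<^sup>2"
proof (rule fps_ext)
  fix n
  have E: "fps_nth (theta_even\<^sup>2) n = 0" if "\<not> [n = 0] (mod 4)"
    using that supp_mod4_power[OF supp_mod4_theta_even, of 2] by (auto simp: supp_mod4_def)
  have O: "fps_nth (theta_odd\<^sup>2) n = 0" if "\<not> [n = 2] (mod 4)"
    using that supp_mod4_power[OF supp_mod4_theta_odd, of 2] by (auto simp: supp_mod4_def)
  have "theta_neg\<^sup>2 = theta\<^sup>2 oo - fps_X"
    by (simp add: theta_neg_def fps_compose_power)
  moreover have "(theta_neg oo fps_X\<^sup>2)\<^sup>2 = theta_neg\<^sup>2 oo fps_X\<^sup>2"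
    by (rule fps_compose_power) simp
  ultimately have D: "fps_nth (theta_even\<^sup>2) n - fps_nth (theta_odd\<^sup>2) n
      = (if even n then (- 1) ^ (n div 2) * fps_nth (theta\<^sup>2) (n div 2) else 0)"
    using arg_cong[OF theta_even_odd_diff, of "\<lambda>f. fps_nth f n"] by (simp add: fps_compose_X_power_nth)
  have T: "(theta oo fps_X\<^sup>2)\<^sup>2 = theta\<^sup>2 oo fps_X\<^sup>2"
    by (rule fps_compose_power) simp
  \<comment> \<open>Both squares vanish at odd \<open>n\<close>, and at even \<open>n\<close>
    exactly one residue class modulo 4 is allowed for each. The sign
    \<open>(- 1) ^ (n div 2)\<close> in \<open>D\<close> matches the sign of the square that can
    survive.\<close>
  have "odd n \<or> n mod 4 = 0 \<or> n mod 4 = 2" by presburger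
  then consider "odd n" | "n mod 4 = 0" | "n mod 4 = 2" by (elim disjE)
  then show "fps_nth (theta_even\<^sup>2 + theta_odd\<^sup>2) n = fps_nth ((theta oo fps_X\<^sup>2)\<^sup>2) n"
  proof cases
    case 1
    then have "n mod 4 \<noteq> 0" "n mod 4 \<noteq> 2" by presburger+
    then show ?thesis using 1 E O unfolding T by (simp add: cong_def fps_compose_X_power_nth)
  next
    case 2
    then have "even n" "even (n div 2)" by presburger+
    then show ?thesis using 2 D O unfolding T by (simp add: cong_def fps_compose_X_power_nth)
  next
    case 3
    then have "even n" "odd (n div 2)" by presburger+
    then show ?thesis using 3 D E unfolding T by (simp add: cong_def fps_compose_X_power_nth)
  qed
qed

text \<open>In the expansion of \<open>P^2\<close> the cross term lives on exponents congruent to 1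
  modulo 4, so the even part of \<open>P^2\<close> is \<open>P(q^2)^2\<close>. Arithmetically,
  \<open>n\<close> and \<open>2 * n\<close> have equally many representations as sums of two
  squares.\<close>

lemma theta_square_bisection: "fps_nth (theta\<^sup>2) (2 * n) = fps_nth (theta\<^sup>2) n"
proof -
  have "supp_mod4 1 (theta_even * theta_odd)"
    using supp_mod4_mult[OF supp_mod4_theta_even supp_mod4_theta_odd] by simp
  moreover have "\<not> [2 * n = 1] (mod 4)"
    by (simp add: cong_def) presburger
  ultimately have "fps_nth (theta_even * theta_odd) (2 * n) = 0"
    by (auto simp: supp_mod4_def)
  moreover have "theta\<^sup>2 = (theta oo fps_X\<^sup>2)\<^sup>2 + of_nat 2 * (theta_even * theta_odd)"
    unfolding theta_even_odd_sum[symmetric]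
    by (subst theta_dissection) (simp add: algebra_simps power2_eq_square)
  moreover have "(theta oo fps_X\<^sup>2)\<^sup>2 = theta\<^sup>2 oo fps_X\<^sup>2"
    by (rule fps_compose_power) simp
  ultimately have "fps_nth (theta\<^sup>2) (2 * n)
      = fps_nth (theta\<^sup>2 oo fps_X\<^sup>2) (2 * n) + fps_nth (of_nat 2 * (theta_even * theta_odd)) (2 * n)"
    by (metis fps_add_nth)
  then show ?thesis
    using \<open>fps_nth (theta_even * theta_odd) (2 * n) = 0\<close>
    by (simp add: fps_compose_X_power_nth flip: fps_of_nat del: of_nat_numeral)
qed

lemma decimate_v0_sym: "decimate 4 v0_sym * theta_neg = theta\<^sup>2"
proof -
  have "decimate 4 v0_sym * theta_neg = decimate 4 ((theta oo fps_X\<^sup>2)\<^sup>2)"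
    unfolding v0_sym_theta[symmetric] by (rule decimate_mult_compose[symmetric]) simp
  also have "(theta oo fps_X\<^sup>2)\<^sup>2 = theta\<^sup>2 oo fps_X\<^sup>2"
    by (rule fps_compose_power) simp
  also have "decimate 4 (theta\<^sup>2 oo fps_X\<^sup>2) = theta\<^sup>2"
    by (rule fps_ext) (simp add: fps_compose_X_power_nth theta_square_bisection)
  finally show ?thesis .
qed

text \<open>Even coefficients of \<open>F(q)\<close> and \<open>F(-q)\<close> agree;
  \<open>n > 0\<close> avoids the constant 1 subtracted in \<open>v0_sym\<close>.\<close>

lemma decimate_v0_sym_nth: "n > 0 \<Longrightarrow> fps_nth (decimate 4 v0_sym) n = 2 * v0 (4 * n)"
  by (simp add: v0_sym_def v0_def)

section \<open>The operator extracting every fourth coefficient\<close>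

text \<open>This is the \<open>b\<close> of the overview. The even part of \<open>P\<close> is
  \<open>P(q^4)\<close>, so dividing by it is multiplication by a series in \<open>q^4\<close>,
  which keeps the exponents modulo 4 visible.\<close>

definition theta_ratio :: "int fps" where
  "theta_ratio = theta_odd * (rinv theta oo fps_X ^ 4)"

text \<open>This is \<open>w = (P / M)^4 = 1 + u\<close>.\<close>

definition theta_quot4 :: "int fps" where
  "theta_quot4 = theta ^ 4 * rinv theta_neg ^ 4"

lemma theta_odd_eq: "theta_odd = theta_even * theta_ratio"
proof -
  have "theta_even * (rinv theta oo fps_X ^ 4) = (theta * rinv theta) oo fps_X ^ 4"
    by (simp add: theta_even_def fps_compose_mult_distrib)
  then have "theta_even * (rinv theta oo fps_X ^ 4) = 1"
    by (simp add: rinv)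
  then show ?thesis
    by (simp add: theta_ratio_def mult.left_commute)
qed

lemma theta_eq: "theta = theta_even * (1 + theta_ratio)"
  by (subst theta_dissection, subst theta_odd_eq) (simp add: algebra_simps)

lemma theta_neg_eq: "theta_neg = theta_even * (1 - theta_ratio)"
  by (subst theta_neg_dissection, subst theta_odd_eq) (simp add: algebra_simps)

lemma fps_nonzeroI: "fps_nth f 0 = 1 \<Longrightarrow> f \<noteq> 0" for f :: "int fps"
  by auto

lemma theta_quot4_neg: "theta_quot4 * theta_neg ^ 4 = theta ^ 4"
proof -
  have "theta_quot4 * theta_neg ^ 4 = theta ^ 4 * (theta_neg * rinv theta_neg) ^ 4"
    by (simp add: theta_quot4_def power_mult_distrib mult_ac)
  then show ?thesis by (simp add: rinv)
qed

text \<open>The right side factors into sum and difference of squares, that is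
  \<open>P(q^2)^2 * M(q^2)^2\<close>, and \<open>P * M = M(q^2)^2\<close> at \<open>q^2\<close>
  turns this into \<open>M(q^4)^4\<close>.\<close>

lemma theta_neg_compose_pow4: "(theta_neg oo fps_X ^ 4) ^ 4 = theta_even ^ 4 - theta_odd ^ 4"
proof -
  have "theta_even ^ 4 - theta_odd ^ 4 = (theta_even\<^sup>2 + theta_odd\<^sup>2) * (theta_even\<^sup>2 - theta_odd\<^sup>2)"
    by (simp add: algebra_simps flip: power_add)
  also have "\<dots> = ((theta * theta_neg) oo fps_X\<^sup>2)\<^sup>2"
    by (simp add: theta_even_odd_diff theta_even_odd_sum fps_compose_mult_distrib power_mult_distrib)
  also have "(theta * theta_neg) oo fps_X\<^sup>2 = (theta_neg oo fps_X ^ 4)\<^sup>2"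
    unfolding theta_mult_theta_neg compose_X2_X2[symmetric] by (simp add: fps_compose_power)
  finally show ?thesis
    by (simp flip: power_mult)
qed

text \<open>\<open>w(q^4)\<close> is the quotient of \<open>theta_even ^ 4\<close> by
  \<open>theta_even ^ 4 - theta_odd ^ 4\<close>. Thus \<open>1 / (1 - b^4)\<close> is a series in
  \<open>q^4\<close>.\<close>

lemma theta_quot4_compose: "(theta_quot4 oo fps_X ^ 4) * (1 - theta_ratio ^ 4) = 1"
proof -
  let ?w = "theta_quot4 oo fps_X ^ 4"
  have "?w * (theta_neg oo fps_X ^ 4) ^ 4 = (theta_quot4 * theta_neg ^ 4) oo fps_X ^ 4"
    by (simp add: fps_compose_mult_distrib fps_compose_power)
  also have "\<dots> = theta_even ^ 4"
    unfolding theta_quot4_neg by (simp add: theta_even_def fps_compose_power)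
  finally have "?w * (theta_even ^ 4 - theta_odd ^ 4) = theta_even ^ 4"
    unfolding theta_neg_compose_pow4 .
  then have "theta_even ^ 4 * (?w * (1 - theta_ratio ^ 4)) = theta_even ^ 4 * 1"
    unfolding theta_odd_eq by (simp add: algebra_simps power_mult_distrib)
  moreover have "theta_even ^ 4 \<noteq> 0"
    using fps_nonzeroI[OF theta_even_nth_0] by simp
  ultimately show ?thesis
    by (metis mult_left_cancel)
qed

lemma theta_ratio_pow4: "theta_ratio ^ 4 * (theta_quot4 oo fps_X ^ 4) = (theta_quot4 - 1) oo fps_X ^ 4"
  using theta_quot4_compose by (simp add: fps_compose_sub_distrib algebra_simps)

text \<open>From \<open>P / M = (1 + b) / (1 - b)\<close> one gets
  \<open>u = 8 * b * (1 + b^2) / (1 - b)^4\<close>, and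
  \<open>1 / (1 - b) = (1 + b) * (1 + b^2) * w(q^4)\<close> clears the denominator.\<close>

lemma theta_quot4_minus_1:
  "theta_quot4 - 1 = 8 * theta_ratio * (1 + theta_ratio\<^sup>2) ^ 5 * (1 + theta_ratio) ^ 4
     * (theta_quot4 oo fps_X ^ 4) ^ 4"
proof -
  let ?w = "theta_quot4 oo fps_X ^ 4" and ?b = theta_ratio and ?A = theta_even
  let ?R = "8 * ?b * (1 + ?b\<^sup>2) ^ 5 * (1 + ?b) ^ 4 * ?w ^ 4"
  have "?R * theta_neg ^ 4 = ?A ^ 4 * (8 * ?b * (1 + ?b\<^sup>2) * (?w * ((1 + ?b\<^sup>2) * (1 + ?b) * (1 - ?b))) ^ 4)"
    unfolding theta_neg_eq by (simp only: power_mult_distrib power_Suc[of "1 + ?b\<^sup>2" 4, simplified] mult_ac)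
  also have "(1 + ?b\<^sup>2) * (1 + ?b) * (1 - ?b) = 1 - ?b ^ 4"
    by (simp add: algebra_simps eval_nat_numeral)
  also have "?A ^ 4 * (8 * ?b * (1 + ?b\<^sup>2) * (?w * (1 - ?b ^ 4)) ^ 4)
      = (?A * (1 + ?b)) ^ 4 - (?A * (1 - ?b)) ^ 4"
    unfolding theta_quot4_compose power_mult_distrib by (simp add: algebra_simps eval_nat_numeral)
  also have "\<dots> = (theta_quot4 - 1) * theta_neg ^ 4"
    unfolding theta_eq[symmetric] theta_neg_eq[symmetric]
    by (simp add: algebra_simps flip: theta_quot4_neg)
  finally show ?thesis
    using fps_nonzeroI[OF theta_neg_nth_0] by simp
qed

section \<open>Monomials in \<open>b\<close> under \<open>U\<close>, and the span of the
  \<open>P * u^k\<close>\<close>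

definition dissection_term :: "nat \<Rightarrow> nat \<Rightarrow> int fps" where
  "dissection_term i N = theta_even * theta_ratio ^ i * (theta_quot4 oo fps_X ^ 4) ^ N"

text \<open>Up to a series in \<open>q^4\<close> the term is \<open>theta_odd ^ i\<close>, whose
  exponents are all congruent to \<open>i\<close> modulo 4.\<close>

lemma decimate_dissection_term_eq_0:
  assumes "\<not> 4 dvd i"
  shows "decimate 4 (dissection_term i N) = 0"
proof -
  have "dissection_term i N = theta_odd ^ i * ((theta * rinv theta ^ i * theta_quot4 ^ N) oo fps_X ^ 4)"
    by (simp add: dissection_term_def theta_even_def theta_ratio_def fps_compose_mult_distrib
        fps_compose_power power_mult_distrib mult_ac)
  then have "decimate 4 (dissection_term i N)
      = decimate 4 (theta_odd ^ i) * (theta * rinv theta ^ i * theta_quot4 ^ N)"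
    by (simp add: decimate_mult_compose)
  also have "decimate 4 (theta_odd ^ i) = 0"
  proof (rule fps_ext)
    fix n
    have "\<not> [4 * n = 1 * i] (mod 4)"
      using assms by (simp add: cong_def mod_eq_0_iff_dvd)
    then show "fps_nth (decimate 4 (theta_odd ^ i)) n = fps_nth 0 n"
      using supp_mod4_power[OF supp_mod4_theta_odd, of i] by (auto simp: supp_mod4_def)
  qed
  finally show ?thesis by simp
qed

text \<open>Since \<open>b^4 * w(q^4) = u(q^4)\<close>, each fourth power of \<open>b\<close> uses
  up one factor \<open>w(q^4)\<close>; \<open>j \<le> N\<close> ensures that there are enough of
  them.\<close>

lemma decimate_dissection_term:
  assumes "j \<le> N"
  shows "decimate 4 (dissection_term (4 * j) N) = theta * (theta_quot4 - 1) ^ j * theta_quot4 ^ (N - j)"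
proof -
  let ?w = "theta_quot4 oo fps_X ^ 4"
  have "?w ^ N = ?w ^ j * ?w ^ (N - j)"
    using assms by (simp flip: power_add)
  then have "dissection_term (4 * j) N = theta_even * (theta_ratio ^ 4 * ?w) ^ j * ?w ^ (N - j)"
    unfolding dissection_term_def power_mult_distrib power_mult[of theta_ratio] by (simp only: mult_ac)
  also have "\<dots> = (theta * (theta_quot4 - 1) ^ j * theta_quot4 ^ (N - j)) oo fps_X ^ 4"
    unfolding theta_ratio_pow4
    by (simp add: theta_even_def fps_compose_mult_distrib fps_compose_power)
  finally show ?thesis
    by (simp add: decimate_compose)
qed

inductive theta_span :: "int fps \<Rightarrow> bool" where
  zero: "theta_span 0"
| add: "theta_span f \<Longrightarrow> theta_span g \<Longrightarrow> theta_span (f + g)"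
| power: "theta_span (theta * (theta_quot4 - 1) ^ Suc k)"

lemma theta_span_sum: "(\<And>x. x \<in> S \<Longrightarrow> theta_span (f x)) \<Longrightarrow> theta_span (sum f S)"
  by (induction S rule: infinite_finite_induct) (auto intro: theta_span.intros)

lemma theta_span_of_nat_mult: "theta_span f \<Longrightarrow> theta_span (of_nat c * f)"
  by (induction c) (auto simp: algebra_simps intro: theta_span.intros)

lemma theta_span_mult_quot4: "theta_span f \<Longrightarrow> theta_span (f * theta_quot4)"
proof (induction rule: theta_span.induct)
  case (power k)
  have "theta * (theta_quot4 - 1) ^ Suc k * theta_quot4
      = theta * (theta_quot4 - 1) ^ Suc k + theta * (theta_quot4 - 1) ^ Suc (Suc k)"
    by (simp add: algebra_simps)
  then show ?case by (metis theta_span.intros)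
qed (auto simp: algebra_simps intro: theta_span.intros)

lemma theta_span_mult_quot4_power: "theta_span f \<Longrightarrow> theta_span (f * theta_quot4 ^ n)"
  by (induction n) (use theta_span_mult_quot4 in \<open>force simp: mult_ac\<close>)+

text \<open>The bounds force \<open>1 \<le> j \<le> N\<close> when \<open>i = 4 * j\<close>, so at
  least one factor \<open>u\<close> appears.\<close>

lemma theta_span_decimate_dissection_term:
  assumes "0 < i" "i < 4 * (N + 1)"
  shows "theta_span (decimate 4 (dissection_term i N))"
proof (cases "4 dvd i")
  case True
  then obtain j where j: "i = 4 * j" ..
  with assms obtain k where "j = Suc k" "j \<le> N"
    by (cases j) auto
  then show ?thesis
    unfolding j using theta_span_mult_quot4_power[OF theta_span.power]
    by (simp only: decimate_dissection_term)
qed (simp add: decimate_dissection_term_eq_0 theta_span.zero)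

lemma dissection_term_expansion:
  "theta_even * theta_ratio ^ k * (theta_ratio + 1) ^ m * (theta_ratio\<^sup>2 + 1) ^ n * (theta_quot4 oo fps_X ^ 4) ^ N
    = (\<Sum>i\<le>m. \<Sum>l\<le>n. of_nat ((m choose i) * (n choose l)) * dissection_term (i + k + 2 * l) N)"
proof -
  let ?b = theta_ratio and ?w = "theta_quot4 oo fps_X ^ 4"
  have "(?b + 1) ^ m * (?b\<^sup>2 + 1) ^ n
      = (\<Sum>i\<le>m. \<Sum>l\<le>n. of_nat ((m choose i) * (n choose l)) * ?b ^ (i + 2 * l))"
    unfolding binomial_ring sum_product
    by (intro sum.cong refl) (simp add: power_add power_mult[symmetric] mult_ac)
  then have "theta_even * ?b ^ k * ((?b + 1) ^ m * (?b\<^sup>2 + 1) ^ n) * ?w ^ N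
      = (\<Sum>i\<le>m. \<Sum>l\<le>n. theta_even * ?b ^ k * (of_nat ((m choose i) * (n choose l)) * ?b ^ (i + 2 * l)) * ?w ^ N)"
    by (simp only: sum_distrib_left sum_distrib_right)
  also have "\<dots> = (\<Sum>i\<le>m. \<Sum>l\<le>n. of_nat ((m choose i) * (n choose l)) * dissection_term (i + k + 2 * l) N)"
    by (intro sum.cong refl) (simp only: dissection_term_def power_add mult_ac)
  finally show ?thesis
    by (simp only: mult.assoc)
qed

lemma theta_span_decimate:
  "theta_span f \<Longrightarrow> \<exists>g. theta_span g \<and> decimate 4 f = 8 * g"
proof (induction rule: theta_span.induct)
  case zero
  then show ?case using theta_span.zero by (intro exI[of _ 0]) simp
next
  case (add f g)
  then obtain f' g' where "theta_span f'" "theta_span g'" "decimate 4 f = 8 * f'" "decimate 4 g = 8 * g'"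
    by blast
  then show ?case
    by (intro exI[of _ "f' + g'"]) (simp add: decimate_add distrib_left theta_span.add)
next
  case (power k)
  let ?w = "theta_quot4 oo fps_X ^ 4" and ?b = theta_ratio
  define K where "K = Suc k"
  define h where "h = (\<Sum>i\<le>4 * K + 1. \<Sum>l\<le>5 * K.
      of_nat (((4 * K + 1) choose i) * ((5 * K) choose l)) * dissection_term (i + K + 2 * l) (4 * K))"
  \<comment> \<open>The formula for \<open>u\<close> to the power \<open>K\<close>, with one more
    factor \<open>1 + b\<close> coming from \<open>P = theta_even * (1 + b)\<close>.\<close>
  have "theta * (theta_quot4 - 1) ^ K
      = 8 ^ K * (theta_even * ?b ^ K * (?b + 1) ^ (4 * K + 1) * (?b\<^sup>2 + 1) ^ (5 * K) * ?w ^ (4 * K))"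
    unfolding theta_quot4_minus_1
    by (subst theta_eq) (simp add: power_mult_distrib power_mult[symmetric] power_add add.commute mult_ac)
  also have "theta_even * ?b ^ K * (?b + 1) ^ (4 * K + 1) * (?b\<^sup>2 + 1) ^ (5 * K) * ?w ^ (4 * K) = h"
    unfolding h_def by (rule dissection_term_expansion)
  finally have "theta * (theta_quot4 - 1) ^ K = of_nat (8 ^ K) * h"
    by simp
  then have "decimate 4 (theta * (theta_quot4 - 1) ^ K) = of_nat (8 ^ K) * decimate 4 h"
    by (simp only: decimate_of_nat_mult)
  also have "\<dots> = 8 * (of_nat (8 ^ k) * decimate 4 h)"
    by (simp add: K_def)
  finally have "decimate 4 (theta * (theta_quot4 - 1) ^ Suc k) = 8 * (of_nat (8 ^ k) * decimate 4 h)"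
    by (simp only: K_def)
  \<comment> \<open>The exponents of \<open>b\<close> in \<open>h\<close> run from
    \<open>K \<ge> 1\<close> to \<open>15 * K + 1\<close>, which is below
    \<open>4 * (4 * K + 1)\<close>.\<close>
  moreover have "theta_span (of_nat (8 ^ k) * decimate 4 h)"
    unfolding h_def decimate_sum decimate_of_nat_mult
    by (intro theta_span_of_nat_mult theta_span_sum theta_span_decimate_dissection_term)
       (auto simp: K_def)
  ultimately show ?case by blast
qed

text \<open>The odd part of \<open>P\<close> has coefficients 0 and 2, so \<open>b\<close> is even,
  and \<open>u\<close> contains the factor \<open>8 * b\<close>.\<close>

lemma theta_span_dvd: "theta_span f \<Longrightarrow> 16 dvd f"
proof (induction rule: theta_span.induct)
  case (power k)
  have "theta_odd = 2 * Abs_fps (\<lambda>n. fps_nth theta_odd n div 2)"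
    by (rule fps_ext) (auto simp: theta_odd_def theta_nth numeral_fps_const)
  then have "2 dvd theta_odd" by (rule dvdI)
  then have "2 dvd theta_ratio" by (simp add: theta_ratio_def)
  then obtain b where b: "theta_ratio = 2 * b" ..
  have "8 * theta_ratio = 16 * b"
    unfolding b by simp
  then have "16 dvd theta_quot4 - 1"
    unfolding theta_quot4_minus_1 mult.assoc by (metis dvd_triv_left dvd_mult2 mult.assoc)
  then show ?case by simp
qed auto

lemma decimate_theta: "decimate 4 theta = theta"
  by (rule fps_ext) (use even_square_iff[of "4 * n" for n] in \<open>simp add: theta_nth\<close>)

lemma decimate_2_v0_sym: "decimate 4 (decimate 4 v0_sym) = theta + 4 * (theta * (theta_quot4 - 1))"
proof -
  let ?w = "theta_quot4 oo fps_X ^ 4" and ?b = theta_ratio and ?A = theta_even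
  let ?G = "?A * ?w * (1 + ?b) ^ 3 * (1 + ?b\<^sup>2)"
  \<comment> \<open>\<open>?G\<close> is \<open>P^2 / M = theta_even * (1 + b)^2 / (1 - b)\<close>
    with the denominator cleared.\<close>
  have "?G * theta_neg = (?A * (1 + ?b))\<^sup>2 * (?w * ((1 + ?b\<^sup>2) * (1 + ?b) * (1 - ?b)))"
    unfolding theta_neg_eq by (simp add: eval_nat_numeral mult_ac)
  also have "(1 + ?b\<^sup>2) * (1 + ?b) * (1 - ?b) = 1 - ?b ^ 4"
    by (simp add: algebra_simps eval_nat_numeral)
  also have "(?A * (1 + ?b))\<^sup>2 * (?w * (1 - ?b ^ 4)) = decimate 4 v0_sym * theta_neg"
    unfolding theta_quot4_compose theta_eq[symmetric] by (simp add: decimate_v0_sym)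
  finally have "decimate 4 v0_sym = ?G"
    using fps_nonzeroI[OF theta_neg_nth_0] by simp
  \<comment> \<open>Of these powers of \<open>b\<close>, \<open>U\<close> keeps only 0 and 4, giving
    \<open>P * w + 3 * P * u = P + 4 * P * u\<close>.\<close>
  also have "?G = dissection_term 0 1 + of_nat 3 * dissection_term 1 1 + of_nat 4 * dissection_term 2 1
      + of_nat 4 * dissection_term 3 1 + of_nat 3 * dissection_term (4 * 1) 1 + dissection_term 5 1"
    by (simp add: dissection_term_def algebra_simps eval_nat_numeral)
  finally have "decimate 4 (decimate 4 v0_sym)
      = decimate 4 (dissection_term (4 * 0) 1) + of_nat 3 * decimate 4 (dissection_term (4 * 1) 1)"
    by (simp only: decimate_add decimate_of_nat_mult) (simp add: decimate_dissection_term_eq_0)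
  then show ?thesis
    by (simp only: decimate_dissection_term) (simp add: decimate_dissection_term algebra_simps)
qed

text \<open>The first step gives the factor 4. Every later one fixes \<open>P\<close> and extracts
  another 8 from the remainder, which stays in the span.\<close>

lemma decimate_funpow_v0_sym:
  "\<exists>f. theta_span f \<and> (decimate 4 ^^ Suc k) (decimate 4 v0_sym) = theta + of_nat (4 * 8 ^ k) * f"
proof (induction k)
  case 0
  show ?case
    using theta_span.power[of 0] decimate_2_v0_sym
    by (intro exI[of _ "theta * (theta_quot4 - 1)"]) simp
next
  case (Suc k)
  then obtain f where f: "theta_span f"
    "(decimate 4 ^^ Suc k) (decimate 4 v0_sym) = theta + of_nat (4 * 8 ^ k) * f" by blast
  obtain g where g: "theta_span g" "decimate 4 f = 8 * g"
    using theta_span_decimate[OF f(1)] by blast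
  have "(decimate 4 ^^ Suc (Suc k)) (decimate 4 v0_sym) = theta + of_nat (4 * 8 ^ k) * (8 * g)"
    unfolding funpow.simps(2)[of "Suc k"] o_apply f(2) decimate_add decimate_of_nat_mult decimate_theta g(2) ..
  with g(1) show ?case
    by (intro exI[of _ g]) (simp add: mult_ac)
qed

section \<open>Divisibility away from the squares\<close>

lemma v0_dvd_of_not_square:
  assumes "k > 0" "\<not> is_square m"
  shows "2 ^ (3 * k + 2) dvd v0 (2 ^ (2 * k + 2) * m)"
proof -
  obtain j where k: "k = Suc j" using assms(1) by (cases k) auto
  have m: "m > 0" using assms(2) by (cases m) auto
  obtain f where f: "theta_span f"
    "(decimate 4 ^^ Suc j) (decimate 4 v0_sym) = theta + of_nat (4 * 8 ^ j) * f"
    using decimate_funpow_v0_sym by blast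
  obtain g where g: "f = 16 * g" using theta_span_dvd[OF f(1)] ..
  have "theta + of_nat (4 * 8 ^ j) * f = theta + of_nat (4 * 8 ^ j * 16) * g"
    by (simp add: g mult_ac)
  with f(2) have eq: "(decimate 4 ^^ Suc j) (decimate 4 v0_sym) = theta + of_nat (4 * 8 ^ j * 16) * g"
    by simp
  have "2 * v0 (4 * (4 ^ k * m)) = fps_nth ((decimate 4 ^^ k) (decimate 4 v0_sym)) m"
    unfolding decimate_funpow_nth by (rule decimate_v0_sym_nth[symmetric]) (use m in simp)
  also have "\<dots> = fps_nth theta m + 4 * 8 ^ j * 16 * fps_nth g m"
    unfolding k eq by (simp flip: fps_of_nat)
  also have "fps_nth theta m = 0"
    using assms(2) m by (simp add: theta_nth)
  \<comment> \<open>The total factor is \<open>4 * 8 ^ j * 16 = 8 * 8 ^ k\<close>; halving leaves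
    \<open>4 * 8 ^ k\<close>, that is \<open>2 ^ (3 * k + 2)\<close>.\<close>
  finally have "v0 (4 * (4 ^ k * m)) = 4 * 8 ^ k * fps_nth g m"
    by (simp add: k)
  moreover have "(2 :: int) ^ (3 * k + 2) = 4 * 8 ^ k" "(2 :: nat) ^ (2 * k + 2) = 4 * 4 ^ k"
    by (simp_all add: power_add power_mult)
  ultimately show ?thesis
    by (simp add: mult.assoc)
qed

theorem corollary1p1:
  fixes \<alpha> p r n :: nat
  assumes "\<alpha> > 0"
    and "prime p"
    and "p \<ge> 3"
    and "\<not> QuadRes (int p) (int r)"
  shows "[v0 (2 ^ (2 * \<alpha> + 2) * (p * n + r)) = 0] (mod 2 ^ (3 * \<alpha> + 2))"
proof -
  \<comment> \<open>A square of this form would exhibit \<open>r\<close> as a square modulo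
    \<open>p\<close>.\<close>
  have "\<not> is_square (p * n + r)"
  proof
    assume "is_square (p * n + r)"
    then obtain k where "p * n + r = k\<^sup>2" by (auto elim!: is_nth_powerE)
    then have "(int k)\<^sup>2 = int p * int n + int r"
      by (metis of_nat_add of_nat_mult of_nat_power)
    then have "[(int k)\<^sup>2 = int r] (mod int p)"
      by (simp add: cong_def)
    with assms(4) show False
      by (auto simp: QuadRes_def)
  qed
  with assms(1) show ?thesis
    unfolding cong_0_iff by (rule v0_dvd_of_not_square)
qed

end
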